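(* Let $(X,d)$ be a metric space, $f:X\to\mathbb{R}\cup\{\pm\infty\}$ a function and $\bar x\in X$ such that $f(\bar x)=0$. If $f^\downarrow(\bar x)>0$, then $f$ admits a local error bound at $\bar x$. Moreover, it holds $$f^\downarrow(\bar x)\le \mathrm{Er}f(\bar x).$$
   Context: $B(x,r)$ denotes the closed ball with center $x$ and radius $r$. The steepest descent rate of $f$ at $\bar x$ is $f^\downarrow(\bar x)=\liminf_{x\to\bar x}\frac{f(x)-f(\bar x)}{d(x,\bar x)}=\sup_{\delta>0}\inf_{x\in B(\bar x,\delta)\setminus\{\bar x\}}\frac{f(x)-f(\bar x)}{d(x,\bar x)}$ (with $\inf\varnothing=+\infty$). Write $[f\le 0]=\{x\in X: f(x)\le 0\}$, $[r]_+=\max\{r,0\}$, and $\mathrm{dist}(x,S)=\inf_{y\in S}d(x,y)$. When $f(\bar x)=0$, $f$ admits a local error bound at $\bar x$ if there exist reals $c>0$ and $r>0$ such that $\mathrm{dist}(x,[f\le 0])\le c[f(x)]_+$ for all $x\in B(\bar x,r)$. The error bound modulus of $f$ at $\bar x$ is $\mathrm{Er}f(\bar x)=\liminf_{x\to\bar x,\ f(x)>0}\frac{f(x)}{\mathrm{dist}(x,[f\le 0])}$ (equal to $+\infty$ if there are no points $x$ with $f(x)>0$ in some neighbourhood of $\bar x$; a quotient with positive numerator and zero denominator is $+\infty$). *)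

theory Defs
  imports "HOL-Analysis.Analysis"
begin

(* Only meaningful for finite f xbar: in ereal, \<infinity> - \<infinity> = \<infinity>.  If xbar is isolated,
   then at xbar = bot and the value is \<infinity>, in accordance with inf {} = \<infinity>. *)
definition steepest_descent_rate :: "('a::metric_space \<Rightarrow> ereal) \<Rightarrow> 'a \<Rightarrow> ereal" where
  "steepest_descent_rate f xbar =
     Liminf (at xbar) (\<lambda>x. (f x - f xbar) / ereal (dist x xbar))"

definition sublevel0 :: "('a \<Rightarrow> ereal) \<Rightarrow> 'a set" where
  "sublevel0 f = {x. f x \<le> 0}"

(* The two notions below are used for f xbar = 0 only.  Then sublevel0 f contains xbar, so
   infdist is the genuine infimum of distances and its value 0 on the empty set plays no role. *)

definition admits_local_error_bound :: "('a::metric_space \<Rightarrow> ereal) \<Rightarrow> 'a \<Rightarrow> bool" where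
  "admits_local_error_bound f xbar \<longleftrightarrow>
     (\<exists>c>0. \<exists>r>0. \<forall>x\<in>cball xbar r.
        ereal (infdist x (sublevel0 f)) \<le> ereal c * max (f x) 0)"

(* The filter is bot, hence the value \<infinity>, if f \<le> 0 near xbar.  For f x > 0 and distance 0,
   division in ereal gives \<infinity>.  Excluding xbar itself is harmless since f xbar = 0. *)
definition error_bound_modulus :: "('a::metric_space \<Rightarrow> ereal) \<Rightarrow> 'a \<Rightarrow> ereal" where
  "error_bound_modulus f xbar =
     Liminf (at xbar within {x. f x > 0}) (\<lambda>x. f x / ereal (infdist x (sublevel0 f)))"

lemma Liminf_at_within_cball:
  fixes g :: "'a::metric_space \<Rightarrow> ereal"
  shows "Liminf (at a within S) g = (SUP \<delta>\<in>{0<..}. INF x\<in>S \<inter> cball a \<delta> - {a}. g x)"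
  unfolding Liminf_within
proof (rule antisym)
  show "(SUP \<delta>\<in>{0<..}. INF x\<in>S \<inter> ball a \<delta> - {a}. g x)
      \<le> (SUP \<delta>\<in>{0<..}. INF x\<in>S \<inter> cball a \<delta> - {a}. g x)"
  proof (rule SUP_mono)
    fix d :: real assume "d \<in> {0<..}"
    then show "\<exists>e\<in>{0<..}. (INF x\<in>S \<inter> ball a d - {a}. g x) \<le> (INF x\<in>S \<inter> cball a e - {a}. g x)"
      by (intro bexI[of _ "d/2"] INF_superset_mono) auto
  qed
  show "(SUP \<delta>\<in>{0<..}. INF x\<in>S \<inter> cball a \<delta> - {a}. g x)
      \<le> (SUP \<delta>\<in>{0<..}. INF x\<in>S \<inter> ball a \<delta> - {a}. g x)"
    by (intro SUP_mono' INF_superset_mono) auto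
qed

lemma steepest_descent_rate_SUP_INF:
  "steepest_descent_rate f xbar =
     (SUP \<delta>\<in>{0<..}. INF x\<in>cball xbar \<delta> - {xbar}. (f x - f xbar) / ereal (dist x xbar))"
  unfolding steepest_descent_rate_def Liminf_at_within_cball by simp

end

theory Submission
  imports Defs
begin

text \<open>As f vanishes at the base point \<open>a\<close>, that point lies in the sublevel set,
  so the distance from x to the set is at most \<open>dist x a\<close>. Where f is positive,
  replacing \<open>dist x a\<close> by this smaller denominator can only raise the quotient, and
  keeping only such points can only raise the lower limit; this gives the inequality of moduli. If
  the rate exceeds a real e > 0, then f x > e * \<open>dist x a\<close> at all points x \<noteq>
  \<open>a\<close> near \<open>a\<close>, which yields an error bound with constant 1/e.\<close>

lemma infdist_sublevel0_le_dist:
  assumes "f a = 0"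
  shows "infdist x (sublevel0 f) \<le> dist x a"
  using assms by (intro infdist_le) (simp add: sublevel0_def)

lemma steepest_descent_rate_le_error_bound_modulus:
  assumes "f a = 0"
  shows "steepest_descent_rate f a \<le> error_bound_modulus f a"
proof -
  \<comment> \<open>An infimum over fewer points of each punctured ball is larger.\<close>
  have "steepest_descent_rate f a \<le> Liminf (at a within {x. f x > 0}) (\<lambda>x. f x / ereal (dist x a))"
    unfolding steepest_descent_rate_def Liminf_at_within_cball
    using assms by (intro SUP_mono' INF_superset_mono) auto
  also have "\<dots> \<le> error_bound_modulus f a"
    unfolding error_bound_modulus_def
  proof (rule Liminf_mono)
    \<comment> \<open>This covers a zero distance to the sublevel set: the inverse of 0 is
      \<infinity> in \<open>ereal\<close>, so antitonicity of the inverse holds on all nonnegative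
      values.\<close>
    have "f x / ereal (dist x a) \<le> f x / ereal (infdist x (sublevel0 f))" if "f x > 0" for x
      unfolding divide_ereal_def
      using that infdist_sublevel0_le_dist[of f a x, OF assms]
      by (intro ereal_mult_left_mono ereal_inverse_antimono) (auto simp: infdist_nonneg)
    then show "\<forall>\<^sub>F x in at a within {x. f x > 0}.
        f x / ereal (dist x a) \<le> f x / ereal (infdist x (sublevel0 f))"
      by (auto simp: eventually_at_filter)
  qed
  finally show ?thesis .
qed

lemma admits_local_error_bound_if_steepest_descent_rate_pos:
  assumes "f a = 0" "steepest_descent_rate f a > 0"
  shows "admits_local_error_bound f a"
proof -
  \<comment> \<open>The rate may be \<infinity>, so a real number strictly below it is
    chosen.\<close>
  obtain e where e: "0 < ereal e" "ereal e < steepest_descent_rate f a"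
    using ereal_dense2[OF assms(2)] by blast
  have "\<forall>\<^sub>F x in at a. ereal e < f x / ereal (dist x a)"
    using less_LiminfD[OF e(2)[unfolded steepest_descent_rate_def]] assms(1) by simp
  then obtain d where d: "d > 0"
    "\<And>x. x \<noteq> a \<Longrightarrow> dist x a \<le> d \<Longrightarrow> ereal e < f x / ereal (dist x a)"
    by (auto simp: eventually_at_le)
  have "ereal (infdist x (sublevel0 f)) \<le> ereal (1 / e) * max (f x) 0" if "x \<in> cball a d" for x
  \<comment> \<open>The lower limit says nothing about \<open>a\<close> itself; there both sides of
    the bound are 0.\<close>
  proof (cases "x = a")
    case True
    then show ?thesis using infdist_sublevel0_le_dist[of f a x, OF assms(1)] assms(1) by simp
  next
    case False
    with d(2)[of x] that have "ereal e < f x / ereal (dist x a)"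
      by (simp add: dist_commute)
    \<comment> \<open>The case split treats infinite values: -\<infinity> would make the quotient
      -\<infinity>, and \<infinity> exceeds every real.\<close>
    with False have less: "ereal (e * dist x a) < f x"
      by (cases "f x") (auto simp: field_simps)
    have "0 \<le> ereal (e * dist x a)"
      using e(1) by simp
    from this less have "f x > 0"
      by (rule le_less_trans)
    with less e(1) have "ereal (dist x a) \<le> ereal (1 / e) * max (f x) 0"
      by (cases "f x") (auto simp: field_simps max_def)
    then show ?thesis
      using infdist_sublevel0_le_dist[of f a x, OF assms(1)] by (meson ereal_less_eq(3) order_trans)
  qed
  with d(1) e(1) show ?thesis
    unfolding admits_local_error_bound_def by (intro exI[of _ "1 / e"] conjI exI[of _ d] ballI) auto
qed

theorem proposition4:
  fixes f :: "'a::metric_space \<Rightarrow> ereal" and xbar :: 'a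
  assumes "f xbar = 0"
  shows "(steepest_descent_rate f xbar > 0 \<longrightarrow> admits_local_error_bound f xbar) \<and>
         steepest_descent_rate f xbar \<le> error_bound_modulus f xbar"
  using assms admits_local_error_bound_if_steepest_descent_rate_pos
    steepest_descent_rate_le_error_bound_modulus by blast

end
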